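(* Let $\mathcal{G}=\mathcal{G}(\mathbb{R}^{1,3})$ be the spacetime algebra and let $N_4\colon\mathcal{G}\to\mathbb{R}$ be given by $N_4(x) := [x^{\square}x]\,x^{\square}x$. Then $$N_4(xy)=N_4(x)\,N_4(y)\qquad\text{for all }x,y\in\mathcal{G}.$$
   Context: $\mathcal{G}(\mathbb{R}^{1,3})$ is the $16$-dimensional associative unital real algebra (Clifford algebra) generated by an orthonormal basis $\gamma_0,\gamma_1,\gamma_2,\gamma_3$ of $\mathbb{R}^{1,3}$ with $\gamma_0^2=1$, $\gamma_1^2=\gamma_2^2=\gamma_3^2=-1$ and $\gamma_i\gamma_j=-\gamma_j\gamma_i$ for $i\ne j$. For $0\le k\le 4$, $\mathcal{G}^k$ is the span of the products $\gamma_{i_1}\cdots\gamma_{i_k}$ with $i_1<\dots<i_k$ (with $\mathcal{G}^0=\mathbb{R}$), so $\mathcal{G}=\bigoplus_{k=0}^4\mathcal{G}^k$. The Clifford conjugate $x\mapsto x^{\square}$ is the linear map acting on $\mathcal{G}^0,\mathcal{G}^1,\mathcal{G}^2,\mathcal{G}^3,\mathcal{G}^4$ as multiplication by $+1,-1,-1,+1,+1$ respectively; it satisfies $(xy)^{\square}=y^{\square}x^{\square}$. The map $x\mapsto[x]$ is the linear map which is the identity on $\mathcal{G}^0$ and multiplication by $-1$ on $\mathcal{G}^k$ for $k\ge1$. One has $x^{\square}x\in\mathcal{G}^0\oplus\mathcal{G}^3\oplus\mathcal{G}^4$, and $[Y]Y\in\mathbb{R}$ for every $Y$ in this subspace, so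 $N_4$ is real-valued. *)

theory Defs
  imports "HOL-Analysis.Analysis"
begin

text \<open>
  The Clifford algebra of \<open>\<real>\<^bsup>1,3\<^esup>\<close>. A multivector is stored as its family of real coefficients
  over the basis blades \<open>\<gamma>\<^sub>A = \<gamma>\<^bsub>i\<^sub>1\<^esub> \<cdots> \<gamma>\<^bsub>i\<^sub>k\<^esub>\<close>, where \<open>A = {i\<^sub>1 < \<dots> < i\<^sub>k}\<close> ranges over the subsets of
  \<open>{0,1,2,3}\<close>. Moving the generators of \<open>\<gamma>\<^sub>B\<close> one by one into place from the right gives
  \<open>\<gamma>\<^sub>A \<gamma>\<^sub>B = \<sigma>(A,B) \<gamma>\<^bsub>A \<Delta> B\<^esub>\<close>, where each pair \<open>(a,b) \<in> A \<times> B\<close> contributes to \<open>\<sigma>(A,B)\<close> the factor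
  \<open>-1\<close> if \<open>a > b\<close> (a transposition), \<open>\<gamma>\<^sub>a\<^sup>2\<close> if \<open>a = b\<close> (a contraction), and \<open>1\<close> otherwise.
\<close>

definition pair_sign :: "nat \<Rightarrow> nat \<Rightarrow> real" where
  "pair_sign a b = (if b < a then -1 else if a = b then (if a = 0 then 1 else -1) else 1)"

definition blade_sign :: "nat set \<Rightarrow> nat set \<Rightarrow> real" where
  "blade_sign A B = (\<Prod>a\<in>A. \<Prod>b\<in>B. pair_sign a b)"

typedef sta = "{f :: nat set \<Rightarrow> real. \<forall>A. \<not> A \<subseteq> {0..3} \<longrightarrow> f A = 0}"
  morphisms coord Abs_sta
  by (rule exI[of _ "\<lambda>_. 0"]) simp

setup_lifting type_definition_sta

lemma coord_outside: "\<not> A \<subseteq> {0..3} \<Longrightarrow> coord x A = 0"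
  using coord[of x] by blast

lemma sta_eqI:
  assumes "\<And>A. A \<subseteq> {0..3} \<Longrightarrow> coord x A = coord y A"
  shows "x = y"
proof -
  have "coord x A = coord y A" for A
    by (cases "A \<subseteq> {0..3}") (auto simp only: assms coord_outside not_False_eq_True)
  then have "coord x = coord y" by (rule ext)
  then show ?thesis by (rule coord_inject[THEN iffD1])
qed

instantiation sta :: real_vector
begin

lift_definition zero_sta :: sta is "\<lambda>_. 0" by simp
lift_definition plus_sta :: "sta \<Rightarrow> sta \<Rightarrow> sta" is "\<lambda>f g A. f A + g A" by simp
lift_definition minus_sta :: "sta \<Rightarrow> sta \<Rightarrow> sta" is "\<lambda>f g A. f A - g A" by simp
lift_definition uminus_sta :: "sta \<Rightarrow> sta" is "\<lambda>f A. - f A" by simp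
lift_definition scaleR_sta :: "real \<Rightarrow> sta \<Rightarrow> sta" is "\<lambda>r f A. r * f A" by simp

instance
  by standard (transfer; auto simp: algebra_simps)+

end

lemma sign_sq [simp]: "pair_sign a b * pair_sign a b = 1"
  by (simp add: pair_sign_def)

lemma prod_sym_diff:
  fixes h :: "'b \<Rightarrow> real"
  assumes fin: "finite A" "finite B" and sq: "\<And>x. h x * h x = 1"
  shows "prod h (sym_diff A B) = prod h A * prod h B"
proof -
  have a: "prod h A = prod h (A - B) * prod h (A \<inter> B)"
    by (subst prod.Int_Diff[OF fin(1), of _ B]) (rule mult.commute)
  have b: "prod h B = prod h (B - A) * prod h (A \<inter> B)"
    by (subst prod.Int_Diff[OF fin(2), of _ A]) (simp only: mult.commute Int_commute)
  have c: "prod h (A \<inter> B) * prod h (A \<inter> B) = 1"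
    by (simp add: sq flip: prod.distrib)
  have "prod h (sym_diff A B) = prod h (A - B) * prod h (B - A)"
    by (rule prod.union_disjoint) (use fin in auto)
  also have "\<dots> = prod h (A - B) * prod h (B - A) * (prod h (A \<inter> B) * prod h (A \<inter> B))"
    by (simp add: c)
  finally show ?thesis
    by (simp add: a b)
qed

lemma blade_sign_sym_diff_left:
  assumes "finite A" "finite B"
  shows "blade_sign (sym_diff A B) C = blade_sign A C * blade_sign B C"
  unfolding blade_sign_def using assms
  by (intro prod_sym_diff) (auto simp flip: prod.distrib)

lemma blade_sign_sym_diff_right:
  assumes "finite B" "finite C"
  shows "blade_sign A (sym_diff B C) = blade_sign A B * blade_sign A C"
proof -
  have "(\<Prod>b\<in>sym_diff B C. pair_sign a b) = (\<Prod>b\<in>B. pair_sign a b) * (\<Prod>b\<in>C. pair_sign a b)" for a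
    using assms by (intro prod_sym_diff) auto
  then show ?thesis
    by (simp only: blade_sign_def prod.distrib)
qed

lemma blade_sign_empty [simp]: "blade_sign {} A = 1" "blade_sign A {} = 1"
  by (simp_all add: blade_sign_def)

instantiation sta :: real_algebra_1
begin

lift_definition one_sta :: sta is "\<lambda>A. if A = {} then 1 else 0" by (rule if_not_P) blast

text \<open>In the coefficient of \<open>\<gamma>\<^sub>C\<close>, the blade \<open>\<gamma>\<^sub>A\<close> on the left pairs with \<open>\<gamma>\<^sub>B\<close>, \<open>B = A \<Delta> C\<close>.\<close>

lift_definition times_sta :: "sta \<Rightarrow> sta \<Rightarrow> sta" is
  "\<lambda>f g C. \<Sum>A\<in>Pow {0..3}. blade_sign A (sym_diff A C) * f A * g (sym_diff A C)"
proof (intro allI impI sum.neutral ballI)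
  fix f g :: "nat set \<Rightarrow> real" and A C :: "nat set"
  assume g: "\<And>A. \<not> A \<subseteq> {0..3} \<Longrightarrow> g A = 0" and C: "\<not> C \<subseteq> {0..3}" and A: "A \<in> Pow {0..3}"
  have "\<not> sym_diff A C \<subseteq> {0..3}" using A C by blast
  then have "g (sym_diff A C) = 0" by (rule g)
  then show "blade_sign A (sym_diff A C) * f A * g (sym_diff A C) = 0" by simp
qed

instance
proof
  fix x y z :: sta and r :: real
  let ?P = "Pow {0..3::nat}"
  have fin: "finite A" if "A \<in> ?P" for A :: "nat set"
    using that finite_subset by blast
  show "x * y * z = x * (y * z)"
  proof (rule sta_eqI)
    fix D :: "nat set" assume D: "D \<subseteq> {0..3}"
    have "coord (x * y * z) D = (\<Sum>A\<in>?P. \<Sum>C\<in>?P.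
        blade_sign C (sym_diff C D) * blade_sign A (sym_diff A C) *
          coord x A * coord y (sym_diff A C) * coord z (sym_diff C D))"
      by (simp add: times_sta.rep_eq sum_distrib_left sum_distrib_right mult.assoc)
        (rule sum.swap[THEN trans], simp add: ac_simps)
    also have "\<dots> = (\<Sum>A\<in>?P. \<Sum>B\<in>?P.
        blade_sign A (sym_diff A D) * blade_sign B (sym_diff B (sym_diff A D)) *
          coord x A * coord y B * coord z (sym_diff B (sym_diff A D)))"
    proof (rule sum.cong[OF refl])
      fix A assume A: "A \<in> ?P"
      show "(\<Sum>C\<in>?P. blade_sign C (sym_diff C D) * blade_sign A (sym_diff A C) *
            coord x A * coord y (sym_diff A C) * coord z (sym_diff C D)) =
          (\<Sum>B\<in>?P. blade_sign A (sym_diff A D) * blade_sign B (sym_diff B (sym_diff A D)) *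
            coord x A * coord y B * coord z (sym_diff B (sym_diff A D)))"
      proof (rule sum.reindex_bij_witness[where i = "sym_diff A" and j = "sym_diff A"])
        fix C assume C: "C \<in> ?P"
        show "sym_diff A (sym_diff A C) = C" by blast
        show "sym_diff A C \<in> ?P" using A C by blast
        have e: "sym_diff (sym_diff A C) (sym_diff A D) = sym_diff C D" by blast
        have s: "sym_diff A D = sym_diff (sym_diff A C) (sym_diff C D)" by blast
        have f: "finite A" "finite C" "finite D" "finite (sym_diff A C)" "finite (sym_diff C D)"
          using fin A C D by auto
        have "blade_sign A (sym_diff A D) * blade_sign (sym_diff A C) (sym_diff C D) =
          blade_sign A (sym_diff A C) * (blade_sign A (sym_diff C D) * blade_sign A (sym_diff C D))
            * blade_sign C (sym_diff C D)"
          unfolding s blade_sign_sym_diff_right[OF f(4,5)] blade_sign_sym_diff_left[OF f(1,2)]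
          by simp
        also have "blade_sign A (sym_diff C D) * blade_sign A (sym_diff C D) = 1"
          by (simp add: blade_sign_def flip: prod.distrib)
        finally show "blade_sign A (sym_diff A D) *
            blade_sign (sym_diff A C) (sym_diff (sym_diff A C) (sym_diff A D)) * coord x A *
            coord y (sym_diff A C) * coord z (sym_diff (sym_diff A C) (sym_diff A D)) =
          blade_sign C (sym_diff C D) * blade_sign A (sym_diff A C) * coord x A *
            coord y (sym_diff A C) * coord z (sym_diff C D)"
          unfolding e by (simp add: ac_simps)
      next
        fix B assume B: "B \<in> ?P"
        show "sym_diff A (sym_diff A B) = B" by blast
        show "sym_diff A B \<in> ?P" using A B by blast
      qed
    qed
    also have "\<dots> = coord (x * (y * z)) D"
      by (simp add: times_sta.rep_eq sum_distrib_left ac_simps)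
    finally show "coord (x * y * z) D = coord (x * (y * z)) D" .
  qed
  show "(x + y) * z = x * z + y * z"
    by (rule sta_eqI) (simp add: times_sta.rep_eq plus_sta.rep_eq algebra_simps sum.distrib)
  show "x * (y + z) = x * y + x * z"
    by (rule sta_eqI) (simp add: times_sta.rep_eq plus_sta.rep_eq algebra_simps sum.distrib)
  show "r *\<^sub>R x * y = r *\<^sub>R (x * y)"
    by (rule sta_eqI) (simp add: times_sta.rep_eq scaleR_sta.rep_eq sum_distrib_left ac_simps)
  show "x * r *\<^sub>R y = r *\<^sub>R (x * y)"
    by (rule sta_eqI) (simp add: times_sta.rep_eq scaleR_sta.rep_eq sum_distrib_left ac_simps)
  show "1 * x = x"
  proof (rule sta_eqI)
    fix C :: "nat set" assume "C \<subseteq> {0..3}"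
    have "coord (1 * x) C = (\<Sum>A\<in>?P. if A = {} then coord x C else 0)"
      unfolding times_sta.rep_eq one_sta.rep_eq by (rule sum.cong) auto
    then show "coord (1 * x) C = coord x C" by (simp add: sum.delta)
  qed
  show "x * 1 = x"
  proof (rule sta_eqI)
    fix C :: "nat set" assume C: "C \<subseteq> {0..3}"
    have "coord (x * 1) C = (\<Sum>A\<in>?P. if A = C then coord x C else 0)"
      unfolding times_sta.rep_eq one_sta.rep_eq
      by (rule sum.cong) (auto simp del: blade_sign_empty intro!: blade_sign_empty)
    then show "coord (x * 1) C = coord x C" using C by (simp add: sum.delta)
  qed
  show "(0::sta) \<noteq> 1"
    by transfer (metis zero_neq_one)
qed

end

lift_definition blade :: "nat set \<Rightarrow> sta" is
  "\<lambda>A B. if B = A \<and> A \<subseteq> {0..3} then 1 else 0" by auto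

definition gamma :: "nat \<Rightarrow> sta" where
  "gamma i = blade {i}"

text \<open>The projection of \<open>\<G> = \<G>\<^sup>0 \<oplus> \<dots> \<oplus> \<G>\<^sup>4\<close> onto \<open>\<G>\<^sup>k\<close>.\<close>

lift_definition grade_part :: "nat \<Rightarrow> sta \<Rightarrow> sta" is
  "\<lambda>k f A. if card A = k then f A else 0" by simp

definition clifford_conj :: "sta \<Rightarrow> sta" where
  "clifford_conj x =
     grade_part 0 x - grade_part 1 x - grade_part 2 x + grade_part 3 x + grade_part 4 x"

definition bracket :: "sta \<Rightarrow> sta" where
  "bracket x = grade_part 0 x - (\<Sum>k=1..4. grade_part k x)"

definition scalar_part :: "sta \<Rightarrow> real" where
  "scalar_part x = coord x {}"

text \<open>
  The element \<open>[x\<^sup>\<box>x] x\<^sup>\<box>x\<close> lies in \<open>\<G>\<^sup>0 = \<real>\<close> (lemma \<open>of_real_N4\<close> below), so taking its scalar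
  part loses nothing.
\<close>

definition N4 :: "sta \<Rightarrow> real" where
  "N4 x = scalar_part (bracket (clifford_conj x * x) * (clifford_conj x * x))"

lemma blade_mult:
  assumes "A \<subseteq> {0..3}" "B \<subseteq> {0..3}"
  shows "blade A * blade B = blade_sign A B *\<^sub>R blade (sym_diff A B)"
proof (rule sta_eqI)
  fix C :: "nat set" assume C: "C \<subseteq> {0..3}"
  have "coord (blade A * blade B) C =
      (\<Sum>A'\<in>Pow {0..3}. if A' = A then (if sym_diff A C = B then blade_sign A B else 0) else 0)"
    unfolding times_sta.rep_eq blade.rep_eq by (rule sum.cong) (use assms in auto)
  also have "\<dots> = (if sym_diff A C = B then blade_sign A B else 0)"
    using assms(1) by (simp add: sum.delta)
  also have "(sym_diff A C = B) = (C = sym_diff A B)" by blast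
  finally show "coord (blade A * blade B) C = coord (blade_sign A B *\<^sub>R blade (sym_diff A B)) C"
    using C assms by (auto simp: scaleR_sta.rep_eq blade.rep_eq)
qed

lemma blade_empty: "blade {} = 1"
  by (rule sta_eqI) (simp add: blade.rep_eq one_sta.rep_eq)

lemma gamma_0_sq: "gamma 0 * gamma 0 = 1"
  by (simp add: gamma_def blade_mult blade_sign_def pair_sign_def blade_empty)

lemma gamma_sq: "i \<in> {1,2,3} \<Longrightarrow> gamma i * gamma i = - 1"
  by (auto simp: gamma_def blade_mult blade_sign_def pair_sign_def blade_empty)

lemma gamma_anticommute:
  assumes "i \<in> {0..3}" "j \<in> {0..3}" "i \<noteq> j"
  shows "gamma i * gamma j = - (gamma j * gamma i)"
proof -
  have "gamma i * gamma j = pair_sign i j *\<^sub>R blade (sym_diff {j} {i})"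
    using assms by (simp add: gamma_def blade_mult blade_sign_def Un_commute)
  moreover have "gamma j * gamma i = pair_sign j i *\<^sub>R blade (sym_diff {j} {i})"
    using assms by (simp add: gamma_def blade_mult blade_sign_def)
  moreover have "pair_sign i j = - pair_sign j i"
    using assms by (simp add: pair_sign_def)
  ultimately show ?thesis by simp
qed

lemma prod_list_gamma:
  assumes "sorted_wrt (<) is" "set is \<subseteq> {0..3}"
  shows "prod_list (map gamma is) = blade (set is)"
  using assms
proof (induction "is")
  case Nil
  then show ?case by (simp add: blade_empty)
next
  case (Cons i "is")
  have "sym_diff {i} (set is) = insert i (set is)"
    using Cons.prems by auto
  moreover have "blade_sign {i} (set is) = 1"
    using Cons.prems by (auto simp: blade_sign_def pair_sign_def intro!: prod.neutral)
  moreover have "prod_list (map gamma is) = blade (set is)" "{i} \<subseteq> {0..3}" "set is \<subseteq> {0..3}"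
    using Cons by auto
  ultimately show ?case
    using blade_mult[of "{i}" "set is"] by (simp add: gamma_def[of i])
qed

lemma coord_sum_blade:
  "coord (\<Sum>A\<in>Pow {0..3}. c A *\<^sub>R blade A) B = (if B \<subseteq> {0..3} then c B else 0)"
proof -
  have "coord (\<Sum>A\<in>S. c A *\<^sub>R blade A) B = (\<Sum>A\<in>S. coord (c A *\<^sub>R blade A) B)" for S
    by (induction S rule: infinite_finite_induct) (auto simp: zero_sta.rep_eq plus_sta.rep_eq)
  also have "(\<Sum>A\<in>Pow {0..3}. coord (c A *\<^sub>R blade A) B) =
      (\<Sum>A\<in>Pow {0..3}. if A = B then c B else 0)"
    by (rule sum.cong) (auto simp: scaleR_sta.rep_eq blade.rep_eq)
  finally show ?thesis by (simp add: sum.delta)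
qed

lemma sta_expansion: "x = (\<Sum>A\<in>Pow {0..3}. coord x A *\<^sub>R blade A)"
  by (rule sta_eqI) (simp add: coord_sum_blade)

lemma inj_blade: "inj_on blade (Pow {0..3})"
  by (rule inj_onI) (metis (no_types, lifting) PowD blade.rep_eq zero_neq_one)

lemma independent_blades: "independent (blade ` Pow {0..3})"
proof (rule independent_if_scalars_zero)
  fix f x assume s: "(\<Sum>x\<in>blade ` Pow {0..3}. f x *\<^sub>R x) = 0" and x: "x \<in> blade ` Pow {0..3}"
  from x obtain A where A: "A \<subseteq> {0..3}" "x = blade A" by blast
  have "(\<Sum>A\<in>Pow {0..3}. f (blade A) *\<^sub>R blade A) = 0"
    using s by (simp add: sum.reindex[OF inj_blade])
  then have "coord (\<Sum>A\<in>Pow {0..3}. f (blade A) *\<^sub>R blade A) A = 0"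
    by (simp add: zero_sta.rep_eq)
  then show "f x = 0"
    using A by (simp add: coord_sum_blade)
qed simp

lemma dim_sta: "dim (UNIV :: sta set) = 16"
proof -
  have "x \<in> span (blade ` Pow {0..3})" for x
    by (subst sta_expansion) (intro span_sum span_scale span_base imageI)
  then have "dim (UNIV :: sta set) = card (blade ` Pow {0..3})"
    by (intro dim_unique[of "blade ` Pow {0..3}"]) (use independent_blades in auto)
  then show ?thesis by (simp add: card_image[OF inj_blade] card_Pow)
qed

lemma range_grade_part:
  "range (grade_part k) =
     span {prod_list (map gamma is) |is. sorted_wrt (<) is \<and> set is \<subseteq> {0..3} \<and> length is = k}"
proof -
  let ?B = "blade ` {A. A \<subseteq> {0..3} \<and> card A = k}"
  have eq: "{prod_list (map gamma is) |is. sorted_wrt (<) is \<and> set is \<subseteq> {0..3} \<and> length is = k} = ?B"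
  proof (intro equalityI subsetI)
    fix x assume "x \<in> {prod_list (map gamma is) |is. sorted_wrt (<) is \<and> set is \<subseteq> {0..3} \<and> length is = k}"
    then obtain "is" where "x = prod_list (map gamma is)" "sorted_wrt (<) is" "set is \<subseteq> {0..3}" "length is = k"
      by blast
    then show "x \<in> ?B"
      by (intro image_eqI[of _ _ "set is"])
        (simp_all only: prod_list_gamma mem_Collect_eq distinct_card strict_sorted_iff simp_thms)
  next
    fix x assume "x \<in> ?B"
    then obtain A where A: "x = blade A" "A \<subseteq> {0..3}" "card A = k" by blast
    moreover have "finite A" using A finite_subset by blast
    ultimately have "x = prod_list (map gamma (sorted_list_of_set A)) \<and>
        sorted_wrt (<) (sorted_list_of_set A) \<and> set (sorted_list_of_set A) \<subseteq> {0..3} \<and>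
        length (sorted_list_of_set A) = k"
      by (simp add: prod_list_gamma)
    then show "x \<in> {prod_list (map gamma is) |is. sorted_wrt (<) is \<and> set is \<subseteq> {0..3} \<and> length is = k}"
      by blast
  qed
  have "grade_part k x \<in> span ?B" for x
  proof -
    have "grade_part k x = (\<Sum>A\<in>Pow {0..3}. coord (grade_part k x) A *\<^sub>R blade A)"
      by (rule sta_expansion)
    also have "\<dots> \<in> span ?B"
    proof (rule span_sum)
      fix A :: "nat set" assume "A \<in> Pow {0..3}"
      then show "coord (grade_part k x) A *\<^sub>R blade A \<in> span ?B"
        by (cases "card A = k")
          (auto simp: grade_part.rep_eq intro!: span_zero span_scale[OF span_base])
    qed
    finally show ?thesis .
  qed
  moreover have "x \<in> range (grade_part k)" if "x \<in> span ?B" for x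
  proof -
    have "grade_part k x = x"
      using that
    proof (induction rule: span_induct_alt)
      case base
      show ?case by (rule sta_eqI) (simp add: grade_part.rep_eq zero_sta.rep_eq)
    next
      case (step c b y)
      have "grade_part k (c *\<^sub>R b + y) = c *\<^sub>R grade_part k b + grade_part k y"
        by (rule sta_eqI) (simp add: grade_part.rep_eq plus_sta.rep_eq scaleR_sta.rep_eq)
      moreover have "grade_part k b = b"
        using step(1) by (intro sta_eqI) (auto simp: grade_part.rep_eq blade.rep_eq)
      ultimately show ?case using step by simp
    qed
    then show ?thesis by (metis rangeI)
  qed
  ultimately show ?thesis unfolding eq by blast
qed

lemma sum_grade_part: "(\<Sum>k=0..4. grade_part k x) = x"
proof (rule sta_eqI)
  fix A :: "nat set" assume "A \<subseteq> {0..3}"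
  then have "card A \<le> card {0..3::nat}" by (intro card_mono) auto
  then have "card A \<in> {0,1,2,3,4}" by auto
  then show "coord (\<Sum>k=0..4. grade_part k x) A = coord x A"
    by (auto simp: plus_sta.rep_eq grade_part.rep_eq zero_sta.rep_eq numeral_eq_Suc)
qed

lemma card_le_4: "A \<subseteq> {0..3::nat} \<Longrightarrow> card A \<in> {0,1,2,3,4}"
  using card_mono[of "{0..3::nat}" A] by auto

lemma coord_clifford_conj:
  assumes "A \<subseteq> {0..3}"
  shows "coord (clifford_conj x) A = (if card A \<in> {1,2} then - coord x A else coord x A)"
proof -
  have "coord (clifford_conj x) A = (if card A = 0 then coord x A else 0) -
      (if card A = 1 then coord x A else 0) - (if card A = 2 then coord x A else 0) +
      (if card A = 3 then coord x A else 0) + (if card A = 4 then coord x A else 0)"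
    by (simp only: clifford_conj_def plus_sta.rep_eq minus_sta.rep_eq grade_part.rep_eq)
  with card_le_4[OF assms] show ?thesis
    by (elim insertE emptyE) simp_all
qed

lemma coord_bracket:
  assumes "A \<subseteq> {0..3}"
  shows "coord (bracket x) A = (if A = {} then coord x A else - coord x A)"
proof -
  have "finite A" using assms finite_subset by blast
  then have 0: "A = {} \<longleftrightarrow> card A = 0" by simp
  have "{1..4::nat} = {1,2,3,4}" by auto
  then have "coord (bracket x) A = (if card A = 0 then coord x A else 0) -
      ((if card A = 1 then coord x A else 0) + ((if card A = 2 then coord x A else 0) +
      ((if card A = 3 then coord x A else 0) + (if card A = 4 then coord x A else 0))))"
    by (simp add: bracket_def plus_sta.rep_eq minus_sta.rep_eq grade_part.rep_eq)
  with card_le_4[OF assms] show ?thesis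
    unfolding 0 by (elim insertE emptyE) simp_all
qed

lemma blade_sign_commute:
  assumes "finite A" "finite B"
  shows "blade_sign A B * blade_sign B A = (-1) ^ (card A * card B + card (A \<inter> B))"
proof -
  have inner: "(\<Prod>b\<in>B. pair_sign a b * pair_sign b a) = (-1) ^ card B * (if a \<in> B then -1 else 1)"
    (is "?l = _") for a
  proof -
    have "?l = (\<Prod>b\<in>B. (-1) * (if a = b then -1 else 1))"
      by (rule prod.cong) (auto simp: pair_sign_def)
    also have "\<dots> = (-1) ^ card B * (if a \<in> B then -1 else 1)"
      by (subst prod.distrib) (simp add: prod.delta assms)
    finally show ?thesis .
  qed
  have "blade_sign A B * blade_sign B A = (\<Prod>a\<in>A. \<Prod>b\<in>B. pair_sign a b * pair_sign b a)"
    unfolding blade_sign_def prod.distrib by (simp only: prod.swap[of _ A B])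
  also have "\<dots> = (\<Prod>a\<in>A. (-1) ^ card B) * (\<Prod>a\<in>A. if a \<in> B then -1 else 1)"
    by (simp only: inner) (rule prod.distrib)
  also have "(\<Prod>a\<in>A. if a \<in> B then -1 else (1::real)) = (-1) ^ card (A \<inter> B)"
    using assms by (simp add: prod.If_cases)
  finally show ?thesis
    by (simp add: power_add mult.commute[of "card A"] flip: power_mult)
qed

lemma blade_sign_flip:
  assumes "A \<subseteq> {0..3}" "B \<subseteq> {0..3}"
  defines "\<epsilon> \<equiv> \<lambda>n::nat. if n \<in> {1,2} then -1 else 1 :: real"
  shows "\<epsilon> (card (sym_diff A B)) * blade_sign A B = \<epsilon> (card A) * \<epsilon> (card B) * blade_sign B A"
proof -
  have fin: "finite A" "finite B" using assms finite_subset by blast+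
  define a b c where "a = card A" and "b = card B" and "c = card (A \<inter> B)"
  have "card (sym_diff A B) = card (A - B) + card (B - A)"
    by (rule card_Un_disjoint) (use fin in auto)
  also have "card (A - B) = a - c"
    using fin by (simp add: card_Diff_subset_Int a_def c_def)
  also have "card (B - A) = b - c"
    using fin by (simp add: card_Diff_subset_Int b_def c_def Int_commute)
  finally have d: "card (sym_diff A B) = (a - c) + (b - c)" .
  have "c \<le> a" "c \<le> b"
    unfolding a_def b_def c_def by (intro card_mono fin; blast)+
  moreover have "a \<in> {0,1,2,3,4}" "b \<in> {0,1,2,3,4}" "c \<in> {0,1,2,3,4}"
    using assms(1,2) unfolding a_def b_def c_def by (intro card_le_4; blast)+
  moreover have "a - c + (b - c) \<le> 4"
  proof -
    have "sym_diff A B \<subseteq> {0..3}" using assms(1,2) by blast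
    from card_le_4[OF this] show ?thesis unfolding d by auto
  qed
  ultimately have e: "\<epsilon> (a - c + (b - c)) * (-1) ^ (a * b + c) = \<epsilon> a * \<epsilon> b"
    unfolding \<epsilon>_def by (elim insertE emptyE) simp_all
  have sq: "blade_sign B A * blade_sign B A = 1"
    by (simp add: blade_sign_def flip: prod.distrib)
  have "blade_sign A B = blade_sign A B * (blade_sign B A * blade_sign B A)"
    by (simp add: sq)
  also have "\<dots> = (-1) ^ (a * b + c) * blade_sign B A"
    using blade_sign_commute[OF fin] unfolding a_def b_def c_def by (simp only: mult.assoc[symmetric])
  finally show ?thesis
    using e unfolding d a_def[symmetric] b_def[symmetric] by (simp only: mult.assoc[symmetric])
qed

lemma clifford_conj_mult: "clifford_conj (x * y) = clifford_conj y * clifford_conj x"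
proof (rule sta_eqI)
  fix C :: "nat set" assume C: "C \<subseteq> {0..3}"
  define \<epsilon> :: "nat \<Rightarrow> real" where "\<epsilon> = (\<lambda>n. if n \<in> {1,2} then -1 else 1)"
  have conj: "coord (clifford_conj z) A = \<epsilon> (card A) * coord z A" if "A \<subseteq> {0..3}" for z A
    using that by (simp add: coord_clifford_conj \<epsilon>_def)
  have "coord (clifford_conj y * clifford_conj x) C = (\<Sum>B\<in>Pow {0..3}.
      blade_sign B (sym_diff B C) * (\<epsilon> (card B) * coord y B) *
        (\<epsilon> (card (sym_diff B C)) * coord x (sym_diff B C)))"
    unfolding times_sta.rep_eq
  proof (rule sum.cong[OF refl])
    fix B assume "B \<in> Pow {0..3::nat}"
    then have "B \<subseteq> {0..3}" "sym_diff B C \<subseteq> {0..3}" using C by blast+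
    then show "blade_sign B (sym_diff B C) * coord (clifford_conj y) B *
        coord (clifford_conj x) (sym_diff B C) = blade_sign B (sym_diff B C) *
        (\<epsilon> (card B) * coord y B) * (\<epsilon> (card (sym_diff B C)) * coord x (sym_diff B C))"
      by (simp only: conj)
  qed
  also have "\<dots> = (\<Sum>A\<in>Pow {0..3}. \<epsilon> (card C) * (blade_sign A (sym_diff A C) * coord x A *
      coord y (sym_diff A C)))"
  proof (rule sum.reindex_bij_witness[where i = "\<lambda>A. sym_diff A C" and j = "\<lambda>A. sym_diff A C"])
    fix B assume B: "B \<in> Pow {0..3::nat}"
    let ?A = "sym_diff B C"
    have e: "sym_diff ?A C = B" "sym_diff ?A B = C" by blast+
    have "\<epsilon> (card C) * blade_sign ?A B = \<epsilon> (card ?A) * \<epsilon> (card B) * blade_sign B ?A"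
      using blade_sign_flip[of ?A B] B C unfolding e \<epsilon>_def by blast
    then have "\<epsilon> (card C) * blade_sign ?A B * (coord x ?A * coord y B) =
        \<epsilon> (card ?A) * \<epsilon> (card B) * blade_sign B ?A * (coord x ?A * coord y B)"
      by (rule arg_cong)
    then show "\<epsilon> (card C) * (blade_sign ?A (sym_diff ?A C) * coord x ?A * coord y (sym_diff ?A C)) =
        blade_sign B ?A * (\<epsilon> (card B) * coord y B) * (\<epsilon> (card ?A) * coord x ?A)"
      unfolding e by (simp only: ac_simps)
  qed (use C in auto)
  also have "\<dots> = coord (clifford_conj (x * y)) C"
    using C by (simp add: conj times_sta.rep_eq sum_distrib_left)
  finally show "coord (clifford_conj (x * y)) C = coord (clifford_conj y * clifford_conj x) C" ..
qed

lemma clifford_conj_involution: "clifford_conj (clifford_conj x) = x"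
  by (rule sta_eqI) (simp add: coord_clifford_conj)

lemma clifford_conj_bracket: "clifford_conj (bracket x) = bracket (clifford_conj x)"
  by (rule sta_eqI) (simp add: coord_clifford_conj coord_bracket)

lemma bracket_commute: "bracket x * x = x * bracket x"
proof -
  have "bracket x = 2 *\<^sub>R coord x {} *\<^sub>R 1 - x"
    by (rule sta_eqI)
      (simp add: coord_bracket minus_sta.rep_eq scaleR_sta.rep_eq one_sta.rep_eq)
  then show ?thesis by (simp only: left_diff_distrib right_diff_distrib) simp
qed

lemma coord_self_conj:
  assumes "clifford_conj x = x" "card A \<in> {1,2}"
  shows "coord x A = 0"
proof (cases "A \<subseteq> {0..3}")
  case True
  then show ?thesis using coord_clifford_conj[OF True, of x] assms by simp
qed (rule coord_outside)

lemma of_real_N4: "of_real (N4 x) = bracket (clifford_conj x * x) * (clifford_conj x * x)"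
proof -
  define Y where "Y = clifford_conj x * x"
  have Y: "clifford_conj Y = Y"
    by (simp add: Y_def clifford_conj_mult clifford_conj_involution)
  then have Z: "clifford_conj (bracket Y * Y) = bracket Y * Y"
    by (simp add: clifford_conj_mult clifford_conj_bracket bracket_commute)
  have "coord (bracket Y * Y) C = 0" if C: "C \<subseteq> {0..3}" "C \<noteq> {}" for C
  proof (cases "card C \<in> {1,2}")
    case True
    then show ?thesis by (rule coord_self_conj[OF Z])
  next
    case False
    have fin: "finite B" if "B \<subseteq> {0..3}" for B :: "nat set"
      using that finite_subset by blast
    have "card C \<noteq> 0" using C fin by simp
    then have C3: "card C \<ge> 3" using False by auto
    let ?t = "\<lambda>A. blade_sign A (sym_diff A C) * coord (bracket Y) A * coord Y (sym_diff A C)"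
    have "?t A = 0" if A: "A \<in> Pow {0..3} - {{}, C}" for A
    proof (rule ccontr)
      assume "?t A \<noteq> 0"
      then have nz: "coord Y A \<noteq> 0" "coord Y (sym_diff A C) \<noteq> 0"
        using A coord_bracket[of A Y] by auto
      then have n12: "card A \<notin> {1,2}" "card (sym_diff A C) \<notin> {1,2}"
        using coord_self_conj[OF Y] by blast+
      have f: "finite A" "finite C" using A C fin by auto
      have "card A \<noteq> 0" using A f by simp
      then have A3: "card A \<ge> 3" using n12 by auto
      have "card (A \<union> C) \<le> card {0..3::nat}" using A C by (intro card_mono) auto
      then have u: "card (A \<union> C) \<le> 4" by simp
      have "card A + card C = card (A \<union> C) + card (A \<inter> C)"
        using f by (rule card_Un_Int)
      moreover have "sym_diff A C = (A \<union> C) - (A \<inter> C)" by blast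
      then have "card (sym_diff A C) = card (A \<union> C) - card (A \<inter> C)"
        using f by (simp only:) (intro card_Diff_subset; blast)
      ultimately have "card (sym_diff A C) \<le> 2" using u A3 C3 by linarith
      moreover have "sym_diff A C \<noteq> {}" using A by blast
      then have "card (sym_diff A C) \<noteq> 0" using f by (simp only: card_0_eq finite_Un finite_Diff) simp
      ultimately show False using n12 by auto
    qed
    then have "(\<Sum>A\<in>Pow {0..3}. ?t A) = (\<Sum>A\<in>{{}, C}. ?t A)"
      using C by (intro sum.mono_neutral_right) auto
    also have "\<dots> = 0"
      using C by (simp add: coord_bracket)
    finally show ?thesis by (simp only: times_sta.rep_eq)
  qed
  then have "bracket Y * Y = of_real (scalar_part (bracket Y * Y))"
    by (intro sta_eqI) (simp add: of_real_def scaleR_sta.rep_eq one_sta.rep_eq scalar_part_def)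
  then show ?thesis by (simp add: N4_def Y_def)
qed

end

theory Submission
  imports Defs
begin

text \<open>
  Write \<open>\<langle>x\<rangle>\<close> for the scalar part; it is a trace, \<open>\<langle>xy\<rangle> = \<langle>yx\<rangle>\<close>. A self-conjugate \<open>Y\<close> is a scalar
  plus an element of \<open>\<G>\<^sup>3 \<oplus> \<G>\<^sup>4\<close> whose square is real, so \<open>Y\<^sup>2 = 2\<langle>Y\<rangle>Y - Q(Y)\<close> with
  \<open>Q(Y) = 2\<langle>Y\<rangle>\<^sup>2 - \<langle>Y\<^sup>2\<rangle>\<close>, and \<open>N\<^sub>4(x) = Q(x\<^sup>\<box>x)\<close>. Polarizing this equation and eliminating the
  product \<open>BY\<close> gives \<open>(YB)\<^sup>2 = 2\<langle>YB\<rangle>YB - Q(Y)Q(B)\<close> for self-conjugate \<open>Y\<close> and \<open>B\<close>. With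
  \<open>Y = x\<^sup>\<box>x\<close> and \<open>B = yy\<^sup>\<box>\<close>, the trace property turns \<open>Q((xy)\<^sup>\<box>xy) = Q(y\<^sup>\<box>Yy)\<close> into
  \<open>2\<langle>YB\<rangle>\<^sup>2 - \<langle>(YB)\<^sup>2\<rangle> = Q(Y)Q(B)\<close>, and \<open>Q(yy\<^sup>\<box>) = Q(y\<^sup>\<box>y)\<close>.
\<close>

lemma scalar_part_simps [simp]:
  "scalar_part (x + y) = scalar_part x + scalar_part y"
  "scalar_part (x - y) = scalar_part x - scalar_part y"
  "scalar_part (r *\<^sub>R x) = r * scalar_part x"
  "scalar_part 1 = 1"
  by (simp_all add: scalar_part_def plus_sta.rep_eq minus_sta.rep_eq scaleR_sta.rep_eq
      one_sta.rep_eq)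

text \<open>In the coefficient at \<open>{}\<close> each blade pairs only with itself, so the sum is
  symmetric in \<open>x\<close> and \<open>y\<close>.\<close>

lemma scalar_part_mult_commute: "scalar_part (x * y) = scalar_part (y * x)"
  by (simp add: scalar_part_def times_sta.rep_eq mult_ac)

lemma clifford_conj_add: "clifford_conj (x + y) = clifford_conj x + clifford_conj y"
  by (rule sta_eqI) (simp add: coord_clifford_conj plus_sta.rep_eq)

lemma clifford_conj_diff: "clifford_conj (x - y) = clifford_conj x - clifford_conj y"
  by (rule sta_eqI) (simp add: coord_clifford_conj minus_sta.rep_eq)

lemma clifford_conj_scaleR: "clifford_conj (r *\<^sub>R x) = r *\<^sub>R clifford_conj x"
  by (rule sta_eqI) (simp add: coord_clifford_conj scaleR_sta.rep_eq)

lemma clifford_conj_one: "clifford_conj 1 = 1"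
  by (rule sta_eqI) (simp add: coord_clifford_conj one_sta.rep_eq)

text \<open>The symmetric difference lies in the union of the two complements, each with at most one
  element.\<close>

lemma card_sym_diff_le_2:
  fixes A B :: "nat set"
  assumes "A \<subseteq> {0..3}" "B \<subseteq> {0..3}" "card A \<ge> 3" "card B \<ge> 3"
  shows "card (sym_diff A B) \<le> 2"
proof -
  have "card ({0..3} - A) \<le> 1" "card ({0..3} - B) \<le> 1"
    using assms by (simp_all add: card_Diff_subset finite_subset[OF _ finite_atLeastAtMost])
  moreover have "card (sym_diff A B) \<le> card (({0..3} - A) \<union> ({0..3} - B))"
    using assms by (intro card_mono) auto
  moreover have "\<dots> \<le> card ({0..3} - A) + card ({0..3} - B)"
    by (rule card_Un_le)
  ultimately show ?thesis by linarith
qed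

text \<open>\<open>V\<close> lives in grades 3 and 4, so \<open>V * V\<close> has no grade above 2;
  being self-conjugate, it has no grade 1 or 2 either.\<close>

lemma self_conj_trace_free_square:
  assumes V: "clifford_conj V = V" and V0: "scalar_part V = 0"
  shows "V * V = scalar_part (V * V) *\<^sub>R 1"
proof -
  have big: "card A \<ge> 3" if "coord V A \<noteq> 0" for A
  proof -
    have A: "A \<subseteq> {0..3}" using that coord_outside by blast
    then have "finite A" using finite_subset by blast
    moreover have "A \<noteq> {}" using that V0 by (auto simp: scalar_part_def)
    ultimately have "card A \<noteq> 0" by simp
    moreover have "card A \<notin> {1,2}" using that coord_self_conj[OF V] by blast
    ultimately show ?thesis by auto
  qed
  have "coord (V * V) C = 0" if C: "C \<subseteq> {0..3}" "C \<noteq> {}" for C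
  proof (cases "card C \<in> {1,2}")
    case True
    have "clifford_conj (V * V) = V * V" by (simp add: clifford_conj_mult V)
    then show ?thesis using True by (rule coord_self_conj)
  next
    case False
    have "finite C" using C finite_subset by blast
    then have "card C \<noteq> 0" using C by simp
    with False have C3: "card C > 2" by auto
    have "coord V A = 0 \<or> coord V (sym_diff A C) = 0" if A: "A \<subseteq> {0..3}" for A
    proof (rule ccontr)
      assume "\<not> ?thesis"
      then have "card A \<ge> 3" "card (sym_diff A C) \<ge> 3" using big by blast+
      moreover have "sym_diff A C \<subseteq> {0..3}" using A C by blast
      ultimately have "card (sym_diff A (sym_diff A C)) \<le> 2"
        using A by (intro card_sym_diff_le_2)
      moreover have "sym_diff A (sym_diff A C) = C" by blast
      ultimately show False using C3 by simp
    qed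
    then show ?thesis
      unfolding times_sta.rep_eq by (intro sum.neutral ballI) (metis PowD mult_eq_0_iff)
  qed
  then show ?thesis
    by (intro sta_eqI) (simp add: scaleR_sta.rep_eq one_sta.rep_eq scalar_part_def)
qed

text \<open>This is the scalar part of \<open>bracket Y * Y\<close>, expressed by traces alone so
  that cyclic shifts apply to it.\<close>

definition quad :: "sta \<Rightarrow> real" where
  "quad Y = 2 * (scalar_part Y)\<^sup>2 - scalar_part (Y * Y)"

lemma self_conj_square:
  assumes Y: "clifford_conj Y = Y"
  shows "Y * Y = (2 * scalar_part Y) *\<^sub>R Y - quad Y *\<^sub>R 1"
proof -
  define a where "a = scalar_part Y"
  define V where "V = Y - a *\<^sub>R 1"
  have "clifford_conj V = V" "scalar_part V = 0"
    by (simp_all add: V_def a_def Y clifford_conj_diff clifford_conj_scaleR clifford_conj_one)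
  then have sq: "V * V = scalar_part (V * V) *\<^sub>R 1"
    by (rule self_conj_trace_free_square)
  have VV: "V * V = Y * Y - (2 * a) *\<^sub>R Y + (a * a) *\<^sub>R 1"
    by (simp add: V_def algebra_simps flip: scaleR_2)
  have "scalar_part (V * V) = a * a - quad Y"
    unfolding VV by (simp add: quad_def a_def power2_eq_square)
  with sq VV have "Y * Y - (2 * a) *\<^sub>R Y + (a * a) *\<^sub>R 1 = (a * a) *\<^sub>R 1 - quad Y *\<^sub>R 1"
    by (simp add: scaleR_left_diff_distrib)
  then show ?thesis
    by (simp add: a_def algebra_simps)
qed

text \<open>Polarization: the quadratic equation of \<open>Y + B\<close> is compared with those of
  \<open>Y\<close> and \<open>B\<close>.\<close>

lemma self_conj_anticommutator:
  assumes Y: "clifford_conj Y = Y" and B: "clifford_conj B = B"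
  defines "a \<equiv> scalar_part Y" and "b \<equiv> scalar_part B"
  shows "B * Y = (2 * a) *\<^sub>R B + (2 * b) *\<^sub>R Y - Y * B + (2 * scalar_part (Y * B) - 4 * a * b) *\<^sub>R 1"
proof -
  have q: "quad (Y + B) = quad Y + quad B + 4 * a * b - 2 * scalar_part (Y * B)"
    by (simp add: quad_def a_def b_def power2_eq_square algebra_simps
        scalar_part_mult_commute[of B Y])
  have "clifford_conj (Y + B) = Y + B"
    by (simp add: clifford_conj_add Y B)
  then have "(Y + B) * (Y + B) = (2 * (a + b)) *\<^sub>R (Y + B) - quad (Y + B) *\<^sub>R 1"
    using self_conj_square by (simp add: a_def b_def)
  then have "Y * Y + B * B + Y * B + B * Y = (2 * (a + b)) *\<^sub>R (Y + B) - quad (Y + B) *\<^sub>R 1"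
    by (simp add: algebra_simps)
  then show ?thesis
    unfolding q self_conj_square[OF Y] self_conj_square[OF B]
    by (simp add: algebra_simps flip: a_def b_def)
qed

text \<open>\<open>Y * B\<close> need not be self-conjugate, so \<open>self_conj_square\<close> does
  not apply to it; instead the inner \<open>B * Y\<close> is rewritten by the
  anticommutator.\<close>

lemma self_conj_mult_square:
  assumes Y: "clifford_conj Y = Y" and B: "clifford_conj B = B"
  shows "(Y * B) * (Y * B) = (2 * scalar_part (Y * B)) *\<^sub>R (Y * B) - (quad Y * quad B) *\<^sub>R 1"
proof -
  define a b t where "a = scalar_part Y" and "b = scalar_part B" and "t = scalar_part (Y * B)"
  have YY: "Y * Y = (2 * a) *\<^sub>R Y - quad Y *\<^sub>R 1"
    using self_conj_square[OF Y] by (simp add: a_def)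
  have BB: "B * B = (2 * b) *\<^sub>R B - quad B *\<^sub>R 1"
    using self_conj_square[OF B] by (simp add: b_def)
  have YYB: "Y * Y * B = (2 * a) *\<^sub>R (Y * B) - quad Y *\<^sub>R B"
    unfolding YY by (simp add: algebra_simps)
  \<comment> \<open>\<open>B * B\<close> is expanded only in the second term, so that
    \<open>Y * (B * B)\<close> cancels in the sum below.\<close>
  have YYBB: "Y * Y * (B * B) =
      (2 * a) *\<^sub>R (Y * (B * B)) - quad Y *\<^sub>R ((2 * b) *\<^sub>R B - quad B *\<^sub>R 1)"
    unfolding YY by (simp add: algebra_simps BB)
  have "(Y * B) * (Y * B) = Y * (B * Y) * B"
    by (simp only: mult.assoc)
  also have "\<dots> = (2 * a) *\<^sub>R (Y * (B * B)) + (2 * b) *\<^sub>R (Y * Y * B) - Y * Y * (B * B)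
      + (2 * t - 4 * a * b) *\<^sub>R (Y * B)"
    unfolding self_conj_anticommutator[OF Y B, folded a_def b_def t_def]
    by (simp add: algebra_simps)
  also have "\<dots> = (2 * t) *\<^sub>R (Y * B) - (quad Y * quad B) *\<^sub>R 1"
    unfolding YYBB YYB by (simp add: algebra_simps)
  finally show ?thesis by (simp add: t_def)
qed

lemma N4_eq_quad: "N4 x = quad (clifford_conj x * x)"
proof -
  have bracket: "bracket Y = (2 * scalar_part Y) *\<^sub>R 1 - Y" for Y
    by (rule sta_eqI)
      (simp add: coord_bracket minus_sta.rep_eq scaleR_sta.rep_eq one_sta.rep_eq scalar_part_def)
  show ?thesis
    by (simp add: N4_def bracket quad_def left_diff_distrib power2_eq_square)
qed

lemma quad_mult_commute: "quad (x * y) = quad (y * x)"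
proof -
  have "scalar_part (x * y * (x * y)) = scalar_part (y * x * (y * x))"
    using scalar_part_mult_commute[of x "y * x * y"] by (simp only: mult.assoc)
  then show ?thesis
    by (simp add: quad_def scalar_part_mult_commute[of x y])
qed

text \<open>Taking scalar parts in the quadratic equation of \<open>Y * B\<close> isolates
  \<open>quad (Y * B)\<close>.\<close>

lemma quad_mult_self_conj:
  assumes "clifford_conj Y = Y" "clifford_conj B = B"
  shows "quad (Y * B) = quad Y * quad B"
  using self_conj_mult_square[OF assms] by (simp add: quad_def[of "Y * B"] power2_eq_square)

theorem theorem5p4:
  fixes x y :: sta
  shows "N4 (x * y) = N4 x * N4 y"
proof -
  define Y B where "Y = clifford_conj x * x" and "B = y * clifford_conj y"
  have "N4 (x * y) = quad (clifford_conj y * (Y * y))"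
    by (simp add: N4_eq_quad clifford_conj_mult Y_def mult.assoc)
  also have "\<dots> = quad (Y * B)"
    by (subst quad_mult_commute) (simp add: B_def mult.assoc)
  also have "\<dots> = quad Y * quad B"
    by (rule quad_mult_self_conj)
      (simp_all add: Y_def B_def clifford_conj_mult clifford_conj_involution)
  also have "quad B = N4 y"
    unfolding B_def N4_eq_quad by (rule quad_mult_commute)
  also have "quad Y = N4 x"
    by (simp add: Y_def N4_eq_quad)
  finally show ?thesis .
qed

end
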